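(* Let $q$ be a prime power, let $n>k\ge 2$ be integers, and let $G\in\mathbb{F}_q^{k\times n}$ be a systematic matrix of rank $k$ with no zero column. Let $d^\perp$ denote the minimum distance of the dual of the code generated by $G$. If $(\lambda_1,\ldots,\lambda_k)\in\Lambda(G)$, then $$\sum_{i=1}^k\Bigl(\min\{\lambda_i,1\}+(d^\perp-1)\max\{0,\lambda_i-1\}\Bigr)\le n.$$
   Context: $G$ is systematic if its first $k$ columns form the $k\times k$ identity matrix. The code generated by $G$ is the row space $\mathcal{C}\le\mathbb{F}_q^n$ of $G$; its dual is $\mathcal{C}^\perp=\{x\in\mathbb{F}_q^n\mid xy^\top=0\text{ for all }y\in\mathcal{C}\}$. The minimum distance of a code is the minimum Hamming weight (number of nonzero entries) of its nonzero vectors. Let $G^\nu$ denote the $\nu$-th column of $G$ and $e_i$ the $i$-th standard basis vector of $\mathbb{F}_q^k$. For $i\in\{1,\ldots,k\}$ let $\mathcal{R}_i^{\mathrm{all}}(G)=\{R\subseteq\{1,\ldots,n\}\mid e_i\in\langle G^\nu\mid\nu\in R\rangle\}$, where $\langle\cdot\rangle$ is the $\mathbb{F}_q$-span. The service rate region $\Lambda(G)\subseteq\mathbb{R}^k$ (with server capacity $1$) is the set of all $(\lambda_1,\ldots,\lambda_k)\in\mathbb{R}^k$ for which there exist real numbers $\lambda_{i,R}\ge 0$ ($i\in\{1,\ldots,k\}$, $R\in\mathcal{R}_i^{\mathrm{all}}(G)$) with $\sum_{R\in\mathcal{R}_i^{\mathrm{all}}(G)}\lambda_{i,R}=\lambda_i$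 for all $i$, and $\sum_{i=1}^k\sum_{R\in\mathcal{R}_i^{\mathrm{all}}(G),\,\nu\in R}\lambda_{i,R}\le 1$ for all $\nu\in\{1,\ldots,n\}$. *)

theory Defs
  imports "Jordan_Normal_Form.DL_Rank"
begin

text \<open>
  The finite field with \<open>q\<close> elements is a type \<open>'a :: {field, finite}\<close> with
  \<open>q = CARD('a)\<close>. A \<open>k\<close> by \<open>n\<close> matrix is an element of \<open>carrier_mat k n\<close>; rows,
  columns and coordinates are indexed from \<open>0\<close>.
\<close>

definition systematic :: "'a :: field mat \<Rightarrow> bool" where
  "systematic G \<longleftrightarrow>
     mat (dim_row G) (dim_row G) (\<lambda>(i, j). G $$ (i, j)) = 1\<^sub>m (dim_row G)"

definition generated_code :: "'a :: field mat \<Rightarrow> 'a vec set" where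
  "generated_code G = vec_space.row_space (dim_col G) G"

definition dual_code :: "nat \<Rightarrow> 'a :: field vec set \<Rightarrow> 'a vec set" where
  "dual_code n C = vec_module.orthogonal_complement n C"

definition hamming_weight :: "'a :: zero vec \<Rightarrow> nat" where
  "hamming_weight x = card {i. i < dim_vec x \<and> x $ i \<noteq> 0}"

text \<open>Unspecified if \<open>C\<close> has no nonzero vector. The dual of a code of dimension \<open>k < n\<close>
  always has one.\<close>

definition min_distance :: "'a :: zero vec set \<Rightarrow> nat" where
  "min_distance C = (LEAST w. \<exists>x\<in>C. x \<noteq> 0\<^sub>v (dim_vec x) \<and> hamming_weight x = w)"

definition recovery_sets :: "'a :: field mat \<Rightarrow> nat \<Rightarrow> nat set set" where
  "recovery_sets G i =
     {R. R \<subseteq> {..<dim_col G} \<and>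
         unit_vec (dim_row G) i \<in>
           LinearCombinations.module.span class_ring (module_vec TYPE('a) (dim_row G)) (col G ` R)}"

text \<open>\<open>x i R\<close> is the rate at which requests for object \<open>i\<close> are served by the recovery
  set \<open>R\<close>; its values outside \<open>R \<in> recovery_sets G i\<close>, \<open>i < dim_row G\<close>, are irrelevant.\<close>

definition service_rate_region :: "'a :: field mat \<Rightarrow> real vec set" where
  "service_rate_region G =
     {l \<in> carrier_vec (dim_row G).
        \<exists>x :: nat \<Rightarrow> nat set \<Rightarrow> real.
          (\<forall>i<dim_row G. \<forall>R\<in>recovery_sets G i. x i R \<ge> 0) \<and>
          (\<forall>i<dim_row G. (\<Sum>R\<in>recovery_sets G i. x i R) = l $ i) \<and>
          (\<forall>v<dim_col G. (\<Sum>i<dim_row G. \<Sum>R\<in>{R \<in> recovery_sets G i. v \<in> R}. x i R) \<le> 1)}"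

end

theory Submission
  imports Defs
begin

text \<open>
  Serving object \<open>i\<close> through a recovery set that avoids the systematic server \<open>i\<close> is expensive:
  writing \<open>e\<^sub>i\<close> as a combination of the columns in such a set and moving column \<open>i\<close> (which
  is \<open>e\<^sub>i\<close> itself) to the other side gives a nonzero dual codeword supported on that set
  and \<open>i\<close>, so the set has at least \<open>d\<^sup>\<bottom> - 1\<close> servers
  (\<open>card_recovery_set_avoiding_systematic_server\<close>). A recovery set that contains server \<open>i\<close>
  may be as small as a single server, but the total rate of these sets is at most \<open>1\<close>, because
  all of them load server \<open>i\<close>.

  Now count the total load of the \<open>n\<close> servers, which is at most \<open>n\<close>. A unit of rate on \<open>R\<close>
  contributes \<open>card R\<close>. If \<open>\<lambda>\<^sub>i = z + y\<close> splits the rate into the parts \<open>z \<le> 1\<close> with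
  and \<open>y\<close> without server \<open>i\<close>, then object \<open>i\<close> contributes at least \<open>z + (d\<^sup>\<bottom> - 1) y\<close>.
  Since \<open>d\<^sup>\<bottom> \<ge> 2\<close>, this is smallest when \<open>z\<close> is as large as possible, namely
  \<open>min \<lambda>\<^sub>i 1\<close>, and the minimum is the summand of the theorem.
\<close>

section \<open>Dual codewords and minimum distance\<close>

lemma in_dual_code_iff:
  fixes G :: "'a :: field mat"
  assumes G: "G \<in> carrier_mat k n"
  shows "x \<in> dual_code n (generated_code G) \<longleftrightarrow>
           x \<in> carrier_vec n \<and> (\<forall>r<k. (\<Sum>j<n. G $$ (r, j) * x $ j) = 0)"
proof -
  interpret vec_space "TYPE('a)" n .
  have "set (rows G) \<subseteq> carrier_vec n"
    using G by (metis carrier_matD(2) rows_carrier)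
  then have *: "dual_code n (generated_code G) = orthogonal_complement (set (rows G))"
    using G by (simp add: dual_code_def generated_code_def row_space_def)
  have "x \<bullet> row G r = (\<Sum>j<n. G $$ (r, j) * x $ j)" if "x \<in> carrier_vec n" "r < k" for r
    using G that by (auto simp: scalar_prod_def lessThan_atLeast0 intro!: sum.cong)
  then show ?thesis
    using G by (auto simp: * orthogonal_complement_def set_conv_nth rows_def)
qed

lemma min_distance_le_hamming_weight:
  assumes "x \<in> C" and "x \<noteq> 0\<^sub>v (dim_vec x)"
  shows "min_distance C \<le> hamming_weight x"
  unfolding min_distance_def using assms by (intro Least_le) blast

lemma min_distance_attained:
  assumes "x \<in> C" and "x \<noteq> 0\<^sub>v (dim_vec x)"
  obtains y where "y \<in> C" and "y \<noteq> 0\<^sub>v (dim_vec y)" and "hamming_weight y = min_distance C"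
proof -
  have "\<exists>w. \<exists>x\<in>C. x \<noteq> 0\<^sub>v (dim_vec x) \<and> hamming_weight x = w"
    using assms by blast
  from LeastI_ex[OF this] show ?thesis
    using that unfolding min_distance_def by blast
qed

lemma systematic_entry:
  assumes "systematic G" and "G \<in> carrier_mat k n" and "r < k" and "i < k"
  shows "G $$ (r, i) = (if r = i then 1 else 0)"
proof -
  have "mat k k (\<lambda>(i, j). G $$ (i, j)) $$ (r, i) = 1\<^sub>m k $$ (r, i)"
    using assms unfolding systematic_def by auto
  then show ?thesis
    using assms by simp
qed

text \<open>
  The column with index \<open>k\<close> is the combination of the unit columns whose coefficients are its own
  entries. This relation shows that the set over which \<open>min_distance\<close> minimizes is nonempty.
\<close>

lemma dual_code_has_nonzero_vector:
  fixes G :: "'a :: field mat"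
  assumes G: "G \<in> carrier_mat k n" and sys: "systematic G" and "k < n"
  obtains x where "x \<in> dual_code n (generated_code G)" and "x \<noteq> 0\<^sub>v (dim_vec x)"
proof
  define x :: "'a vec"
    where "x = vec n (\<lambda>j. if j < k then G $$ (j, k) else if j = k then - 1 else 0)"
  have "x $ k \<noteq> 0\<^sub>v (dim_vec x) $ k"
    using \<open>k < n\<close> by (simp add: x_def)
  then show "x \<noteq> 0\<^sub>v (dim_vec x)"
    by metis
  have "(\<Sum>j<n. G $$ (r, j) * x $ j) = 0" if r: "r < k" for r
  proof -
    have "(\<Sum>j<n. G $$ (r, j) * x $ j) = (\<Sum>j<Suc k. G $$ (r, j) * x $ j)"
      using \<open>k < n\<close> by (intro sum.mono_neutral_right) (auto simp: x_def)
    also have "\<dots> = (\<Sum>j<k. G $$ (r, j) * x $ j) - G $$ (r, k)"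
      using \<open>k < n\<close> by (simp add: x_def)
    also have "(\<Sum>j<k. G $$ (r, j) * x $ j) = (\<Sum>j<k. if r = j then G $$ (j, k) else 0)"
      using \<open>k < n\<close> r by (intro sum.cong) (auto simp: x_def systematic_entry[OF sys G])
    also have "\<dots> - G $$ (r, k) = 0"
      using r by simp
    finally show ?thesis .
  qed
  then show "x \<in> dual_code n (generated_code G)"
    by (simp add: in_dual_code_iff[OF G] x_def)
qed

text \<open>A dual codeword of weight one would force the column at its only nonzero position to vanish.\<close>

lemma two_le_hamming_weight_dual:
  fixes G :: "'a :: field mat"
  assumes G: "G \<in> carrier_mat k n" and cols: "\<forall>j<n. col G j \<noteq> 0\<^sub>v k"
    and x: "x \<in> dual_code n (generated_code G)" and nz: "x \<noteq> 0\<^sub>v (dim_vec x)"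
  shows "2 \<le> hamming_weight x"
proof (rule ccontr)
  assume "\<not> 2 \<le> hamming_weight x"
  have dim: "dim_vec x = n" and orth: "\<And>r. r < k \<Longrightarrow> (\<Sum>j<n. G $$ (r, j) * x $ j) = 0"
    using x by (auto simp: in_dual_code_iff[OF G])
  let ?S = "{j. j < dim_vec x \<and> x $ j \<noteq> 0}"
  obtain j where j: "j < n" "x $ j \<noteq> 0"
    using nz dim by (metis eq_vecI index_zero_vec)
  have "card ?S \<le> Suc 0"
    using \<open>\<not> 2 \<le> hamming_weight x\<close> by (simp add: hamming_weight_def)
  then have unique: "x $ j' = 0" if "j' < n" "j' \<noteq> j" for j'
    using j that dim by (auto simp: card_le_Suc0_iff_eq)
  have "G $$ (r, j) = 0" if "r < k" for r
  proof -
    have "(\<Sum>j'<n. G $$ (r, j') * x $ j') = (\<Sum>j'\<in>{j}. G $$ (r, j') * x $ j')"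
      using j unique by (intro sum.mono_neutral_right) auto
    then show ?thesis
      using orth[OF that] j by simp
  qed
  then have "col G j = 0\<^sub>v k"
    using G j by (intro eq_vecI) auto
  with cols j show False
    by blast
qed

section \<open>Recovery sets\<close>

text \<open>
  The linear combinations behind \<open>span\<close> run over a set of vectors. Coefficients indexed by column
  positions, as needed for a codeword, require one position to be chosen for each vector, since
  several columns may coincide.
\<close>

lemma span_cols_coefficients:
  fixes G :: "'a :: field mat"
  assumes G: "G \<in> carrier_mat k n" and R: "R \<subseteq> {..<n}"
    and v: "v \<in> LinearCombinations.module.span class_ring (module_vec TYPE('a) k) (col G ` R)"
  obtains c where "\<And>r. r < k \<Longrightarrow> v $ r = (\<Sum>j\<in>R. c j * G $$ (r, j))"
proof -
  interpret vec_space "TYPE('a)" k .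
  obtain a A where A: "v = lincomb a A" "finite A" "A \<subseteq> col G ` R"
    using in_spanE[OF v] by blast
  obtain P where P: "P \<subseteq> R" "inj_on (col G) P" "A = col G ` P"
    using A(3) by (meson subset_image_inj)
  have carrier: "A \<subseteq> carrier_vec k"
    using A(3) col_dim[of G] G by auto
  have "v $ r = (\<Sum>j\<in>R. (if j \<in> P then a (col G j) else 0) * G $$ (r, j))" if "r < k" for r
  proof -
    have "v $ r = (\<Sum>u\<in>A. a u * u $ r)"
      using A(1) lincomb_index[OF that carrier] by simp
    also have "\<dots> = (\<Sum>j\<in>P. a (col G j) * G $$ (r, j))"
      unfolding P(3) sum.reindex[OF P(2)] o_def
      using G P(1) R that by (intro sum.cong) (auto simp: subset_iff)
    also have "\<dots> = (\<Sum>j\<in>R. (if j \<in> P then a (col G j) else 0) * G $$ (r, j))"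
      using P(1) R by (intro sum.mono_neutral_cong_left) (auto intro: finite_subset)
    finally show ?thesis .
  qed
  then show ?thesis
    by (rule that)
qed

lemma card_recovery_set_avoiding_systematic_server:
  fixes G :: "'a :: field mat"
  assumes G: "G \<in> carrier_mat k n" and sys: "systematic G" and "k \<le> n" and i: "i < k"
    and R: "R \<in> recovery_sets G i" and "i \<notin> R"
  shows "min_distance (dual_code n (generated_code G)) \<le> card R + 1"
proof -
  have sub: "R \<subseteq> {..<n}"
    and v: "unit_vec k i \<in> LinearCombinations.module.span class_ring (module_vec TYPE('a) k) (col G ` R)"
    using R G by (auto simp: recovery_sets_def)
  obtain c where c: "\<And>r. r < k \<Longrightarrow> unit_vec k i $ r = (\<Sum>j\<in>R. c j * G $$ (r, j))"
    using span_cols_coefficients[OF G sub v] by blast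
  have fin: "finite R"
    using sub finite_subset by blast
  define x where "x = vec n (\<lambda>j. if j = i then - 1 else if j \<in> R then c j else 0)"
  have "x $ i \<noteq> 0\<^sub>v (dim_vec x) $ i"
    using i \<open>k \<le> n\<close> by (simp add: x_def)
  then have nz: "x \<noteq> 0\<^sub>v (dim_vec x)"
    by metis
  have "(\<Sum>j<n. G $$ (r, j) * x $ j) = 0" if r: "r < k" for r
  proof -
    have "(\<Sum>j<n. G $$ (r, j) * x $ j) = (\<Sum>j\<in>insert i R. G $$ (r, j) * x $ j)"
      using sub i \<open>k \<le> n\<close> by (intro sum.mono_neutral_right) (auto simp: x_def)
    also have "\<dots> = - G $$ (r, i) + (\<Sum>j\<in>R. G $$ (r, j) * x $ j)"
      using fin \<open>i \<notin> R\<close> i \<open>k \<le> n\<close> by (simp add: x_def)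
    also have "(\<Sum>j\<in>R. G $$ (r, j) * x $ j) = (\<Sum>j\<in>R. c j * G $$ (r, j))"
      using sub \<open>i \<notin> R\<close> by (intro sum.cong) (auto simp: x_def subset_iff)
    also have "\<dots> = G $$ (r, i)"
      using c[OF r] systematic_entry[OF sys G r i] r i by (auto simp: unit_vec_def)
    finally show ?thesis
      by simp
  qed
  then have "x \<in> dual_code n (generated_code G)"
    by (simp add: in_dual_code_iff[OF G] x_def)
  then have "min_distance (dual_code n (generated_code G)) \<le> hamming_weight x"
    using nz by (rule min_distance_le_hamming_weight)
  also have "\<dots> \<le> card (insert i R)"
    unfolding hamming_weight_def using fin by (intro card_mono) (auto simp: x_def split: if_splits)
  also have "\<dots> = card R + 1"
    using fin \<open>i \<notin> R\<close> by simp
  finally show ?thesis .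
qed

section \<open>Counting the load\<close>

text \<open>
  Weight on a set through \<open>i\<close> is charged at least \<open>1\<close> and any other weight at least \<open>m \<ge> 1\<close>,
  so the cheapest distribution sends as much weight as possible through \<open>i\<close>, up to the
  capacity \<open>1\<close> of that point, and only the excess is charged \<open>m\<close>.
\<close>

lemma weighted_card_lower_bound:
  fixes w :: "'b set \<Rightarrow> real" and m :: real
  assumes fin: "finite F" and nonneg: "\<And>R. R \<in> F \<Longrightarrow> 0 \<le> w R" and "1 \<le> m"
    and size_in: "\<And>R. R \<in> F \<Longrightarrow> i \<in> R \<Longrightarrow> 1 \<le> real (card R)"
    and size_out: "\<And>R. R \<in> F \<Longrightarrow> i \<notin> R \<Longrightarrow> m \<le> real (card R)"
    and cap: "(\<Sum>R\<in>{R \<in> F. i \<in> R}. w R) \<le> 1"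
  shows "min (\<Sum>R\<in>F. w R) 1 + m * max 0 ((\<Sum>R\<in>F. w R) - 1) \<le> (\<Sum>R\<in>F. real (card R) * w R)"
proof -
  define z where "z = (\<Sum>R\<in>{R \<in> F. i \<in> R}. w R)"
  define y where "y = (\<Sum>R\<in>{R \<in> F. i \<notin> R}. w R)"
  have split: "(\<Sum>R\<in>F. f R) = (\<Sum>R\<in>{R \<in> F. i \<in> R}. f R) + (\<Sum>R\<in>{R \<in> F. i \<notin> R}. f R)"
    for f :: "'b set \<Rightarrow> real"
    using fin by (subst sum.union_disjoint[symmetric]) (auto intro: sum.cong)
  have "0 \<le> y"
    unfolding y_def using nonneg by (intro sum_nonneg) auto
  have "min (z + y) 1 + m * max 0 (z + y - 1) \<le> z + m * y"
  proof (cases "z + y \<le> 1")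
    case True
    then show ?thesis
      using mult_right_mono[OF \<open>1 \<le> m\<close> \<open>0 \<le> y\<close>] by simp
  next
    case False
    have "0 \<le> (m - 1) * (1 - z)"
      using \<open>1 \<le> m\<close> cap by (simp add: z_def)
    then show ?thesis
      using False by (simp add: algebra_simps)
  qed
  also have "z + m * y \<le> (\<Sum>R\<in>F. real (card R) * w R)"
    unfolding split z_def y_def sum_distrib_left
  proof (rule add_mono)
    show "(\<Sum>R\<in>{R \<in> F. i \<in> R}. w R) \<le> (\<Sum>R\<in>{R \<in> F. i \<in> R}. real (card R) * w R)"
      using mult_right_mono[OF size_in nonneg] by (intro sum_mono) auto
    show "(\<Sum>R\<in>{R \<in> F. i \<notin> R}. m * w R) \<le> (\<Sum>R\<in>{R \<in> F. i \<notin> R}. real (card R) * w R)"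
      using mult_right_mono[OF size_out nonneg] by (intro sum_mono) auto
  qed
  finally show ?thesis
    by (simp add: split[of w] z_def y_def)
qed

lemma sum_load_eq_weighted_card:
  fixes w :: "'b set \<Rightarrow> real"
  assumes "finite F" and "finite V" and "\<And>R. R \<in> F \<Longrightarrow> R \<subseteq> V"
  shows "(\<Sum>v\<in>V. \<Sum>R\<in>{R \<in> F. v \<in> R}. w R) = (\<Sum>R\<in>F. real (card R) * w R)"
proof -
  have "(\<Sum>v\<in>V. \<Sum>R\<in>{R \<in> F. v \<in> R}. w R) = (\<Sum>R\<in>F. \<Sum>v\<in>{v \<in> V. v \<in> R}. w R)"
    using assms(1,2) by (intro sum.swap_restrict) auto
  also have "\<dots> = (\<Sum>R\<in>F. real (card R) * w R)"
  proof (intro sum.cong refl)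
    fix R assume "R \<in> F"
    then have "{v \<in> V. v \<in> R} = R"
      using assms(3) by blast
    then show "(\<Sum>v\<in>{v \<in> V. v \<in> R}. w R) = real (card R) * w R"
      by simp
  qed
  finally show ?thesis .
qed

theorem theorem5p3:
  fixes G :: "'a :: {field, finite} mat"
    and k n :: nat
    and l :: "real vec"
  assumes "2 \<le> k" and "k < n"
    and "G \<in> carrier_mat k n"
    and "systematic G"
    and "vec_space.rank k G = k"
    and "\<forall>j<n. col G j \<noteq> 0\<^sub>v k"
    and "l \<in> service_rate_region G"
  shows "(\<Sum>i<k. min (l $ i) 1
            + (real (min_distance (dual_code n (generated_code G))) - 1) * max 0 (l $ i - 1))
         \<le> real n"
proof -
  let ?C = "dual_code n (generated_code G)"
  let ?F = "recovery_sets G"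
  note G = assms(3) and sys = assms(4)
  have dims: "dim_row G = k" "dim_col G = n"
    using G by auto
  obtain x where nonneg: "\<And>i R. i < k \<Longrightarrow> R \<in> ?F i \<Longrightarrow> 0 \<le> x i R"
    and rate: "\<And>i. i < k \<Longrightarrow> (\<Sum>R\<in>?F i. x i R) = l $ i"
    and cap: "\<And>v. v < n \<Longrightarrow> (\<Sum>i<k. \<Sum>R\<in>{R \<in> ?F i. v \<in> R}. x i R) \<le> 1"
    using assms(7) unfolding service_rate_region_def dims by auto
  have sub: "R \<subseteq> {..<n}" if "R \<in> ?F i" for i R
    using that by (simp add: recovery_sets_def dims)
  have fin: "finite (?F i)" for i
    using sub by (intro finite_subset[of "?F i" "Pow {..<n}"]) auto
  have "2 \<le> min_distance ?C"
    using dual_code_has_nonzero_vector[OF G sys \<open>k < n\<close>] min_distance_attained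
      two_le_hamming_weight_dual[OF G assms(6)] by metis
  then have dist: "1 \<le> real (min_distance ?C) - 1"
    by simp
  have "(\<Sum>i<k. min (l $ i) 1 + (real (min_distance ?C) - 1) * max 0 (l $ i - 1))
      \<le> (\<Sum>i<k. \<Sum>R\<in>?F i. real (card R) * x i R)"
  proof (rule sum_mono)
    fix i assume "i \<in> {..<k}"
    then have i: "i < k"
      by simp
    have load_i: "(\<Sum>R\<in>{R \<in> ?F i. i \<in> R}. x i R) \<le> 1"
    proof -
      have "(\<Sum>R\<in>{R \<in> ?F i. i \<in> R}. x i R) \<le> (\<Sum>i'<k. \<Sum>R\<in>{R \<in> ?F i'. i \<in> R}. x i' R)"
        using i nonneg
        by (intro member_le_sum[of i "{..<k}" "\<lambda>i'. \<Sum>R\<in>{R \<in> ?F i'. i \<in> R}. x i' R"])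
          (auto intro!: sum_nonneg)
      also have "\<dots> \<le> 1"
        using i \<open>k < n\<close> by (intro cap) simp
      finally show ?thesis .
    qed
    have size_in: "1 \<le> real (card R)" if "R \<in> ?F i" "i \<in> R" for R
      using sub[OF that(1)] that(2) by (auto simp: Suc_le_eq card_gt_0_iff dest: finite_subset)
    have size_out: "real (min_distance ?C) - 1 \<le> real (card R)" if "R \<in> ?F i" "i \<notin> R" for R
      using card_recovery_set_avoiding_systematic_server[OF G sys _ i that] \<open>k < n\<close> by simp
    show "min (l $ i) 1 + (real (min_distance ?C) - 1) * max 0 (l $ i - 1)
        \<le> (\<Sum>R\<in>?F i. real (card R) * x i R)"
      using weighted_card_lower_bound[OF fin nonneg[OF i] dist size_in size_out load_i]
      by (simp add: rate[OF i])
  qed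
  also have "\<dots> = (\<Sum>i<k. \<Sum>v<n. \<Sum>R\<in>{R \<in> ?F i. v \<in> R}. x i R)"
    using sub by (simp add: sum_load_eq_weighted_card[OF fin])
  also have "\<dots> = (\<Sum>v<n. \<Sum>i<k. \<Sum>R\<in>{R \<in> ?F i. v \<in> R}. x i R)"
    by (rule sum.swap)
  also have "\<dots> \<le> (\<Sum>v<n. 1)"
    using cap by (intro sum_mono) simp
  finally show ?thesis
    by simp
qed

end
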